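(* Let $(L,[\cdot,\dots,\cdot],\varepsilon,\alpha,\beta)$ be an $n$-BiHom-Lie color algebra and $\gamma:L\to L$ an averaging operator of $L$. Then $(L,\{\cdot,\dots,\cdot\},\varepsilon,\alpha,\beta)$ is another $n$-BiHom-Lie color algebra, with $$\{x_1,\dots,x_n\}=[x_1,\dots,\gamma(x_i),\dots,\gamma(x_j),\dots,x_n]$$ ($\gamma$ applied in the two fixed positions $i<j$).
   Context: $\mathbb K$ is a field of characteristic different from $2$, $\Gamma$ is an abelian group (written additively) with identity element $e$, and all spaces are $\Gamma$-graded $\mathbb K$-vector spaces. A (skew-symmetric) bicharacter is a map $\varepsilon:\Gamma\times\Gamma\to\mathbb K^*$ with $\varepsilon(a,b)\varepsilon(b,a)=1$, $\varepsilon(a,b+c)=\varepsilon(a,b)\varepsilon(a,c)$, $\varepsilon(a+b,c)=\varepsilon(a,c)\varepsilon(b,c)$. Inside $\varepsilon$ and inside sums of arguments of $\varepsilon$, a homogeneous element stands for its degree. A (multi)linear map is even if it has degree zero (it preserves degree). An $n$-BiHom-Lie color algebra is a $5$-tuple $(L,[\cdot,\dots,\cdot],\varepsilon,\alpha,\beta)$ with $L$ a $\Gamma$-graded vector space, $[\cdot,\dots,\cdot]:L\times\dots\times L\to L$ an even $n$-linear map, $\varepsilon$ a bicharacter and $\alpha,\beta:L\to L$ even linear maps such that, for all homogeneous elements: (1) $\alpha\circ\beta=\beta\circ\alpha$; (2) $[\beta(x_1),\dots,\beta(x_k),\beta(x_{k+1}),\dots,\beta(x_{n-1}),\alpha(x_n)]=-\varepsilon(x_k,x_{k+1})[\beta(x_1),\dots,\beta(x_{k+1}),\beta(x_k),\dots,\beta(x_{n-1}),\alpha(x_n)]$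 for $k=1,\dots,n-2$, and $[\beta(x_1),\dots,\beta(x_{n-1}),\alpha(x_n)]=-\varepsilon(x_{n-1},x_n)[\beta(x_1),\dots,\beta(x_{n-2}),\beta(x_n),\alpha(x_{n-1})]$; (3) $[\beta^2(x_1),\dots,\beta^2(x_{n-1}),[\beta(y_1),\dots,\beta(y_{n-1}),\alpha(y_n)]]=\sum_{k=1}^n\varepsilon(X,Y_k)[\beta^2(y_1),\dots,\beta^2(y_{k-1}),[\beta(x_1),\dots,\beta(x_{n-1}),\alpha(y_k)],\beta^2(y_{k+1}),\dots,\beta^2(y_n)]$, where $X=\sum_{k=1}^{n-1}x_k$ and $Y_k=\sum_{l=1}^{k}y_{l-1}$ with $y_0=e$ (that is, $Y_k$ is the sum of the degrees of $y_1,\dots,y_{k-1}$). An averaging operator of $(L,[\cdot,\dots,\cdot],\varepsilon,\alpha,\beta)$ is an even linear map $\gamma:L\to L$ such that $\gamma\alpha=\alpha\gamma$, $\gamma\beta=\beta\gamma$ and, for all $x_1,\dots,x_n\in L$ and all positions $p\neq q$ in $\{1,\dots,n\}$, applying $\gamma$ to the bracket with $\gamma$ inserted in position $p$ equals the bracket with $\gamma$ inserted in positions $p$ and $q$: $\gamma[x_1,\dots,\gamma(x_p),\dots,x_n]=[x_1,\dots,\gamma(x_p),\dots,\gamma(x_q),\dots,x_n]$ (the two marked positions being in either order). *)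

theory Defs
  imports Complex_Main "HOL-Combinatorics.Transposition"
begin

text \<open>
  The group \<open>\<Gamma>\<close> is the type \<open>'g\<close>, the field is the type \<open>'k\<close>, and \<open>L a\<close> is the homogeneous
  component of degree \<open>a\<close>. Degrees are passed explicitly, because the zero vector lies in every
  component: a statement about homogeneous \<open>x\<close> quantifies over all \<open>d\<close> with \<open>x \<in> L d\<close>.
\<close>

locale graded_vector_space = vector_space scale
  for scale :: "'k::field \<Rightarrow> 'v::ab_group_add \<Rightarrow> 'v" +
  fixes L :: "'g::ab_group_add \<Rightarrow> 'v set"
  assumes subspace_component: "subspace (L a)"
    and direct_sum: "\<exists>!f. (\<forall>a. f a \<in> L a) \<and> finite {a. f a \<noteq> 0} \<and> v = (\<Sum>a | f a \<noteq> 0. f a)"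

definition bicharacter :: "('g::ab_group_add \<Rightarrow> 'g \<Rightarrow> 'k::field) \<Rightarrow> bool" where
  "bicharacter \<epsilon> \<longleftrightarrow>
     (\<forall>a b. \<epsilon> a b \<noteq> 0) \<and>
     (\<forall>a b. \<epsilon> a b * \<epsilon> b a = 1) \<and>
     (\<forall>a b c. \<epsilon> a (b + c) = \<epsilon> a b * \<epsilon> a c) \<and>
     (\<forall>a b c. \<epsilon> (a + b) c = \<epsilon> a c * \<epsilon> b c)"

definition even_linear ::
  "('k::field \<Rightarrow> 'v::ab_group_add \<Rightarrow> 'v) \<Rightarrow> ('g \<Rightarrow> 'v set) \<Rightarrow> ('v \<Rightarrow> 'v) \<Rightarrow> bool" where
  "even_linear scale L f \<longleftrightarrow>
     Vector_Spaces.linear scale scale f \<and> (\<forall>a. \<forall>v \<in> L a. f v \<in> L a)"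

text \<open>
  An \<open>n\<close>-tuple \<open>(x\<^sub>1, \<dots>, x\<^sub>n)\<close> is a function on \<open>nat\<close> of which only the values on \<open>{1..n}\<close> matter;
  the first conjunct says that \<open>m\<close> is indeed a map on \<open>n\<close>-tuples.
\<close>

definition multilinear ::
  "nat \<Rightarrow> ('k::field \<Rightarrow> 'v::ab_group_add \<Rightarrow> 'v) \<Rightarrow> ((nat \<Rightarrow> 'v) \<Rightarrow> 'v) \<Rightarrow> bool" where
  "multilinear n scale m \<longleftrightarrow>
     (\<forall>x y. (\<forall>l \<in> {1..n}. x l = y l) \<longrightarrow> m x = m y) \<and>
     (\<forall>x. \<forall>p \<in> {1..n}. Vector_Spaces.linear scale scale (\<lambda>v. m (x(p := v))))"

definition even_multilinear ::
  "nat \<Rightarrow> ('k::field \<Rightarrow> 'v::ab_group_add \<Rightarrow> 'v) \<Rightarrow> ('g::ab_group_add \<Rightarrow> 'v set)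
     \<Rightarrow> ((nat \<Rightarrow> 'v) \<Rightarrow> 'v) \<Rightarrow> bool" where
  "even_multilinear n scale L m \<longleftrightarrow>
     multilinear n scale m \<and>
     (\<forall>x d. (\<forall>l \<in> {1..n}. x l \<in> L (d l)) \<longrightarrow> m x \<in> L (\<Sum>l = 1..n. d l))"

text \<open>
  \<open>(\<beta> \<circ> x)(n := \<alpha> (x n))\<close> is the tuple \<open>(\<beta> x\<^sub>1, \<dots>, \<beta> x\<^sub>n\<^sub>-\<^sub>1, \<alpha> x\<^sub>n)\<close>. In \<open>skew_symmetry\<close> the entries
  \<open>x\<^sub>k\<close>, \<open>x\<^sub>k\<^sub>+\<^sub>1\<close> are exchanged before \<open>\<alpha>\<close> and \<open>\<beta>\<close> are applied, so that the case \<open>k = n - 1\<close> reads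
  \<open>[\<dots>, \<beta> x\<^sub>n\<^sub>-\<^sub>1, \<alpha> x\<^sub>n] = - \<epsilon>(x\<^sub>n\<^sub>-\<^sub>1, x\<^sub>n) [\<dots>, \<beta> x\<^sub>n, \<alpha> x\<^sub>n\<^sub>-\<^sub>1]\<close>.
\<close>

locale n_BiHom_Lie_color_algebra = graded_vector_space scale L
  for n :: nat
    and scale :: "'k::field \<Rightarrow> 'v::ab_group_add \<Rightarrow> 'v"
    and L :: "'g::ab_group_add \<Rightarrow> 'v set"
    and bracket :: "(nat \<Rightarrow> 'v) \<Rightarrow> 'v"
    and \<epsilon> :: "'g \<Rightarrow> 'g \<Rightarrow> 'k"
    and \<alpha> :: "'v \<Rightarrow> 'v"
    and \<beta> :: "'v \<Rightarrow> 'v" +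
  assumes even_bracket: "even_multilinear n scale L bracket"
    and bicharacter: "bicharacter \<epsilon>"
    and even_alpha: "even_linear scale L \<alpha>"
    and even_beta: "even_linear scale L \<beta>"
    and commute: "\<alpha> \<circ> \<beta> = \<beta> \<circ> \<alpha>"
    and skew_symmetry:
      "\<And>x d k. \<lbrakk>\<forall>l \<in> {1..n}. x l \<in> L (d l); 1 \<le> k; k < n\<rbrakk> \<Longrightarrow>
         bracket ((\<beta> \<circ> x)(n := \<alpha> (x n))) =
         - scale (\<epsilon> (d k) (d (k + 1)))
             (let x' = x \<circ> transpose k (k + 1) in bracket ((\<beta> \<circ> x')(n := \<alpha> (x' n))))"
    and Jacobi:
      "\<And>x y d e. \<lbrakk>\<forall>l \<in> {1..n - 1}. x l \<in> L (d l); \<forall>l \<in> {1..n}. y l \<in> L (e l)\<rbrakk> \<Longrightarrow>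
         bracket ((\<beta> \<circ> \<beta> \<circ> x)(n := bracket ((\<beta> \<circ> y)(n := \<alpha> (y n))))) =
         (\<Sum>k = 1..n. scale (\<epsilon> (\<Sum>l = 1..n - 1. d l) (\<Sum>l = 1..<k. e l))
            (bracket ((\<beta> \<circ> \<beta> \<circ> y)(k := bracket ((\<beta> \<circ> x)(n := \<alpha> (y k)))))))"

locale averaging_operator = n_BiHom_Lie_color_algebra n scale L bracket \<epsilon> \<alpha> \<beta>
  for n :: nat
    and scale :: "'k::field \<Rightarrow> 'v::ab_group_add \<Rightarrow> 'v"
    and L :: "'g::ab_group_add \<Rightarrow> 'v set"
    and bracket :: "(nat \<Rightarrow> 'v) \<Rightarrow> 'v"
    and \<epsilon> :: "'g \<Rightarrow> 'g \<Rightarrow> 'k"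
    and \<alpha> :: "'v \<Rightarrow> 'v"
    and \<beta> :: "'v \<Rightarrow> 'v" +
  fixes \<gamma> :: "'v \<Rightarrow> 'v"
  assumes even_gamma: "even_linear scale L \<gamma>"
    and commute_alpha: "\<gamma> \<circ> \<alpha> = \<alpha> \<circ> \<gamma>"
    and commute_beta: "\<gamma> \<circ> \<beta> = \<beta> \<circ> \<gamma>"
    and averaging:
      "\<And>x p q. \<lbrakk>p \<in> {1..n}; q \<in> {1..n}; p \<noteq> q\<rbrakk> \<Longrightarrow>
         \<gamma> (bracket (x(p := \<gamma> (x p)))) = bracket (x(p := \<gamma> (x p), q := \<gamma> (x q)))"

end

theory Submission
  imports Defs
begin

text \<open>
  Averaging in both orders shows that, as long as \<open>n \<ge> 2\<close>, \<open>\<gamma> [\<dots>, \<gamma> x\<^sub>p, \<dots>]\<close> does not depend on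
  the position \<open>p\<close>, and that it equals the new bracket, whatever the two marked positions are.
  So for skew-symmetry at \<open>k\<close> one may mark the positions \<open>k\<close> and \<open>k + 1\<close>. For the Jacobi identity,
  mark position \<open>1\<close> of \<open>x\<close> and positions \<open>i\<close>, \<open>j\<close> of \<open>y\<close>, and apply \<open>\<gamma>\<close> to the old identity.
  The summands \<open>k = i\<close> and \<open>k = j\<close> are then already nested new brackets; in every other summand
  the outer bracket has one \<open>\<gamma>\<close> too many and the inner one lacks one, and averaging moves the
  mark at \<open>j\<close> to position \<open>k\<close>, where it completes the inner bracket.
\<close>

context averaging_operator
begin

abbreviation mark :: "nat \<Rightarrow> (nat \<Rightarrow> 'v) \<Rightarrow> nat \<Rightarrow> 'v" where
  "mark p x \<equiv> x(p := \<gamma> (x p))"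

lemma linear_gamma: "Vector_Spaces.linear scale scale \<gamma>"
  using even_gamma by (simp add: even_linear_def)

lemma gamma_component: "v \<in> L a \<Longrightarrow> \<gamma> v \<in> L a"
  using even_gamma by (simp add: even_linear_def)

lemma mark_component: "\<forall>l \<in> S. x l \<in> L (d l) \<Longrightarrow> \<forall>l \<in> S. mark p x l \<in> L (d l)"
  by (auto intro: gamma_component)

lemma mark_commute: "mark p (mark q x) = mark q (mark p x)"
  by (cases "p = q") (auto simp: fun_eq_iff)

lemma gamma_alpha: "\<gamma> (\<alpha> v) = \<alpha> (\<gamma> v)"
  using commute_alpha by (metis comp_apply)

lemma gamma_beta: "\<gamma> (\<beta> v) = \<beta> (\<gamma> v)"
  using commute_beta by (metis comp_apply)

text \<open>Holds because \<open>\<gamma>\<close> commutes with \<open>\<alpha>\<close> and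
  \<open>\<beta>\<close>, so position \<open>n\<close>, where the twist is \<open>\<alpha>\<close>,
  needs no separate treatment later.\<close>

lemma mark_twist:
  "mark p ((\<beta> \<circ> x)(n := \<alpha> (x n))) = (\<beta> \<circ> mark p x)(n := \<alpha> (mark p x n))"
  by (auto simp: fun_eq_iff gamma_alpha gamma_beta)

lemma averaging_mark:
  assumes "p \<in> {1..n}" "q \<in> {1..n}" "p \<noteq> q"
  shows "\<gamma> (bracket (mark p x)) = bracket (mark q (mark p x))"
  using averaging[OF assms] assms(3) by simp

end

locale marked_averaging_operator =
  averaging_operator n scale L bracket \<epsilon> \<alpha> \<beta> \<gamma>
  for n :: nat
    and scale :: "'k::field \<Rightarrow> 'v::ab_group_add \<Rightarrow> 'v"
    and L :: "'g::ab_group_add \<Rightarrow> 'v set"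
    and bracket :: "(nat \<Rightarrow> 'v) \<Rightarrow> 'v"
    and \<epsilon> :: "'g \<Rightarrow> 'g \<Rightarrow> 'k"
    and \<alpha> \<beta> \<gamma> :: "'v \<Rightarrow> 'v" +
  fixes i j :: nat
  assumes positions: "1 \<le> i" "i < j" "j \<le> n"
begin

definition averaged :: "(nat \<Rightarrow> 'v) \<Rightarrow> 'v" where
  "averaged x = bracket (x(i := \<gamma> (x i), j := \<gamma> (x j)))"

lemma averaged_eq_bracket_ij: "averaged x = bracket (mark j (mark i x))"
  using positions by (simp add: averaged_def)

lemma averaged_eq_gamma:
  assumes p: "p \<in> {1..n}"
  shows "averaged x = \<gamma> (bracket (mark p x))"
proof -
  \<comment> \<open>For \<open>q \<noteq> r\<close> both sides equal the bracket marked at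
    \<open>q\<close> and \<open>r\<close>, since marks commute.\<close>
  have indep: "\<gamma> (bracket (mark q x)) = \<gamma> (bracket (mark r x))"
    if "q \<in> {1..n}" "r \<in> {1..n}" for q r
    using that by (cases "q = r") (metis averaging_mark mark_commute)+
  show ?thesis
    using averaging_mark[of i j x] indep[OF p, of i] positions
    by (simp add: averaged_eq_bracket_ij)
qed

lemma averaged_eq_bracket:
  assumes "p \<in> {1..n}" "q \<in> {1..n}" "p \<noteq> q"
  shows "averaged x = bracket (mark q (mark p x))"
  using averaging_mark[OF assms] averaged_eq_gamma[OF assms(1)] by simp

lemma averaged_even_multilinear: "even_multilinear n scale L averaged"
proof -
  have cong: "bracket x = bracket y" if "\<forall>l \<in> {1..n}. x l = y l" for x y
    using that even_bracket by (auto simp: even_multilinear_def multilinear_def)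
  have linear: "Vector_Spaces.linear scale scale (\<lambda>v. bracket (x(p := v)))"
    if "p \<in> {1..n}" for x p
    using that even_bracket by (simp add: even_multilinear_def multilinear_def)
  have "averaged x = averaged y" if "\<forall>l \<in> {1..n}. x l = y l" for x y
    unfolding averaged_def using that positions by (intro cong) auto
  moreover have "Vector_Spaces.linear scale scale (\<lambda>v. averaged (x(p := v)))"
    if p: "p \<in> {1..n}" for x p
  proof -
    \<comment> \<open>One of \<open>i\<close>, \<open>j\<close> differs from \<open>p\<close>. With
      the mark at \<open>q\<close>, slot \<open>p\<close> is left untouched, and the new bracket in
      that slot is \<open>\<gamma>\<close> after a linear map.\<close>
    obtain q where q: "q \<in> {1..n}" "q \<noteq> p"
      using positions by (metis atLeastAtMost_iff le_trans less_imp_le order.strict_implies_not_eq)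
    have "averaged (x(p := v)) = \<gamma> (bracket ((mark q x)(p := v)))" for v
      using q by (simp add: averaged_eq_gamma[OF q(1)] fun_upd_twist)
    then show ?thesis
      using Vector_Spaces.linear_compose[OF linear[OF p] linear_gamma] by (simp add: comp_def)
  qed
  moreover have "averaged x \<in> L (\<Sum>l = 1..n. d l)" if "\<forall>l \<in> {1..n}. x l \<in> L (d l)" for x d
    using mark_component[OF mark_component[OF that]] even_bracket
    unfolding averaged_eq_bracket_ij even_multilinear_def by blast
  ultimately show ?thesis
    unfolding even_multilinear_def multilinear_def by blast
qed

lemma averaged_skew_symmetry:
  assumes x: "\<forall>l \<in> {1..n}. x l \<in> L (d l)" and k: "1 \<le> k" "k < n"
  shows "averaged ((\<beta> \<circ> x)(n := \<alpha> (x n))) =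
    - scale (\<epsilon> (d k) (d (k + 1)))
        (let x' = x \<circ> transpose k (k + 1) in averaged ((\<beta> \<circ> x')(n := \<alpha> (x' n))))"
proof -
  define z where "z = mark (k + 1) (mark k x)"
  have twist: "averaged ((\<beta> \<circ> y)(n := \<alpha> (y n))) =
      bracket ((\<beta> \<circ> mark (k + 1) (mark k y))(n := \<alpha> (mark (k + 1) (mark k y) n)))" for y
  proof -
    have "averaged z = bracket (mark (k + 1) (mark k z))" for z
      using k by (intro averaged_eq_bracket) auto
    then show ?thesis
      by (simp only: mark_twist)
  qed
  \<comment> \<open>The marked set is stable under the transposition, so marking commutes with the
    exchange of entries.\<close>
  have swap: "mark (k + 1) (mark k (x \<circ> transpose k (k + 1))) = z \<circ> transpose k (k + 1)"
    by (auto simp: z_def fun_eq_iff transpose_def)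
  have "\<forall>l \<in> {1..n}. z l \<in> L (d l)"
    unfolding z_def by (intro mark_component x)
  from skew_symmetry[OF this k] show ?thesis
    unfolding Let_def twist swap z_def[symmetric] .
qed

lemma averaged_Jacobi:
  assumes x: "\<forall>l \<in> {1..n - 1}. x l \<in> L (d l)" and y: "\<forall>l \<in> {1..n}. y l \<in> L (e l)"
  shows "averaged ((\<beta> \<circ> \<beta> \<circ> x)(n := averaged ((\<beta> \<circ> y)(n := \<alpha> (y n))))) =
    (\<Sum>k = 1..n. scale (\<epsilon> (\<Sum>l = 1..n - 1. d l) (\<Sum>l = 1..<k. e l))
       (averaged ((\<beta> \<circ> \<beta> \<circ> y)(k := averaged ((\<beta> \<circ> x)(n := \<alpha> (y k)))))))"
proof -
  interpret gamma: Vector_Spaces.linear scale scale \<gamma>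
    by (rule linear_gamma)
  have n: "1 \<noteq> n" "1 \<in> {1..n}" "n \<in> {1..n}" and ij: "i \<in> {1..n}" "j \<in> {1..n}" "i \<noteq> j"
    using positions by auto
  \<comment> \<open>As \<open>1 \<noteq> n\<close>, this mark survives the overwriting of slot
    \<open>n\<close> in both the outer and the inner brackets.\<close>
  define x' where "x' = mark 1 x"
  define y' where "y' = mark j (mark i y)"
  have inner_y: "bracket ((\<beta> \<circ> y')(n := \<alpha> (y' n))) = averaged ((\<beta> \<circ> y)(n := \<alpha> (y n)))"
    unfolding averaged_eq_bracket_ij mark_twist y'_def ..
  \<comment> \<open>There are two ways to complete the single mark of \<open>x'\<close>: a second
    mark on the last entry, as here, or an outer \<open>\<gamma>\<close>, as in
    \<open>gamma_inner_x\<close>.\<close>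
  have inner_x: "bracket ((\<beta> \<circ> x')(n := \<alpha> (\<gamma> v))) = averaged ((\<beta> \<circ> x)(n := \<alpha> v))" for v
  proof -
    have "(\<beta> \<circ> x')(n := \<alpha> (\<gamma> v)) = mark n (mark 1 ((\<beta> \<circ> x)(n := \<alpha> v)))"
      using n by (auto simp: x'_def fun_eq_iff gamma_alpha gamma_beta)
    then show ?thesis
      using averaged_eq_bracket[OF n(2,3,1)] by simp
  qed
  have gamma_inner_x: "\<gamma> (bracket ((\<beta> \<circ> x')(n := \<alpha> v))) = averaged ((\<beta> \<circ> x)(n := \<alpha> v))" for v
  proof -
    have "(\<beta> \<circ> x')(n := \<alpha> v) = mark 1 ((\<beta> \<circ> x)(n := \<alpha> v))"
      using n by (auto simp: x'_def fun_eq_iff gamma_beta)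
    then show ?thesis
      using averaged_eq_gamma[OF n(2)] by simp
  qed
  have outer: "\<gamma> (bracket ((\<beta> \<circ> \<beta> \<circ> y')(k := bracket ((\<beta> \<circ> x')(n := \<alpha> (y' k)))))) =
      averaged ((\<beta> \<circ> \<beta> \<circ> y)(k := averaged ((\<beta> \<circ> x)(n := \<alpha> (y k)))))"
    if k: "k \<in> {1..n}" for k
  proof -
    let ?w = "bracket ((\<beta> \<circ> x')(n := \<alpha> (y k)))"
    let ?v = "averaged ((\<beta> \<circ> x)(n := \<alpha> (y k)))"
    let ?z = "\<lambda>v. (\<beta> \<circ> \<beta> \<circ> y)(k := v)"
    consider "k = i" | "k = j" | "k \<noteq> i" "k \<noteq> j" by blast
    then show ?thesis
    proof cases
      case 1
      \<comment> \<open>Inserting the inner bracket at \<open>i\<close> erases the outer mark there.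
        The mark of \<open>y' i\<close> has gone into the inner bracket, and the outer
        \<open>\<gamma>\<close> compensates for the erased one.\<close>
      have "(\<beta> \<circ> \<beta> \<circ> y')(k := ?v) = mark j (?z ?v)"
        using 1 ij by (auto simp: y'_def fun_eq_iff gamma_beta)
      moreover have "y' k = \<gamma> (y k)" using 1 ij by (simp add: y'_def)
      ultimately show ?thesis using averaged_eq_gamma[OF ij(2)] by (simp add: inner_x)
    next
      case 2
      have "(\<beta> \<circ> \<beta> \<circ> y')(k := ?v) = mark i (?z ?v)"
        using 2 ij by (auto simp: y'_def fun_eq_iff gamma_beta)
      moreover have "y' k = \<gamma> (y k)" using 2 ij by (simp add: y'_def)
      ultimately show ?thesis using averaged_eq_gamma[OF ij(1)] by (simp add: inner_x)
    next
      case 3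
      have "(\<beta> \<circ> \<beta> \<circ> y')(k := ?w) = mark j (mark i (?z ?w))"
        using 3 ij by (auto simp: y'_def fun_eq_iff gamma_beta)
      then have "\<gamma> (bracket ((\<beta> \<circ> \<beta> \<circ> y')(k := ?w))) = \<gamma> (averaged (?z ?w))"
        by (simp only: averaged_eq_bracket_ij)
      \<comment> \<open>The marked pair \<open>i\<close>, \<open>j\<close> is exchanged for
        \<open>i\<close>, \<open>k\<close>; the mark at \<open>k\<close> then acts on
        \<open>?w\<close> and turns it into \<open>?v\<close>.\<close>
      also have "\<dots> = \<gamma> (bracket (mark k (mark i (?z ?w))))"
        using averaged_eq_bracket[OF ij(1) k] 3 by simp
      also have "mark k (mark i (?z ?w)) = mark i (?z ?v)"
        using 3 by (auto simp: fun_eq_iff gamma_inner_x)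
      also have "\<gamma> (bracket (mark i (?z ?v))) = averaged (?z ?v)"
        using averaged_eq_gamma[OF ij(1)] by simp
      finally have "\<gamma> (bracket ((\<beta> \<circ> \<beta> \<circ> y')(k := ?w))) = averaged (?z ?v)" .
      moreover have "y' k = y k" using 3 by (simp add: y'_def)
      ultimately show ?thesis by (simp only:)
    qed
  qed
  have lhs: "(\<beta> \<circ> \<beta> \<circ> x')(n := v) = mark 1 ((\<beta> \<circ> \<beta> \<circ> x)(n := v))" for v
    using n by (auto simp: x'_def fun_eq_iff gamma_beta)
  have "\<forall>l \<in> {1..n - 1}. x' l \<in> L (d l)" "\<forall>l \<in> {1..n}. y' l \<in> L (e l)"
    unfolding x'_def y'_def by (intro mark_component x y)+
  \<comment> \<open>Marks preserve degrees, so the coefficients are already the required ones. On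
    the left, \<open>\<gamma>\<close> joins the mark at \<open>1\<close> to form the new outer
    bracket; on the right, it passes through the sum by linearity.\<close>
  from arg_cong[OF Jacobi[OF this], of \<gamma>] show ?thesis
    unfolding inner_y lhs averaged_eq_gamma[OF n(2), symmetric]
    by (simp add: gamma.sum gamma.scale outer)
qed

end

theorem theorem3p17:
  fixes scale :: "'k::field \<Rightarrow> 'v::ab_group_add \<Rightarrow> 'v"
    and L :: "'g::ab_group_add \<Rightarrow> 'v set"
    and bracket :: "(nat \<Rightarrow> 'v) \<Rightarrow> 'v"
    and \<epsilon> :: "'g \<Rightarrow> 'g \<Rightarrow> 'k"
    and \<alpha> \<beta> \<gamma> :: "'v \<Rightarrow> 'v"
    and n i j :: nat
  assumes "CHAR('k) \<noteq> 2"
    and "n_BiHom_Lie_color_algebra n scale L bracket \<epsilon> \<alpha> \<beta>"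
    and "averaging_operator n scale L bracket \<epsilon> \<alpha> \<beta> \<gamma>"
    and "1 \<le> i" and "i < j" and "j \<le> n"
  shows "n_BiHom_Lie_color_algebra n scale L
           (\<lambda>x. bracket (x(i := \<gamma> (x i), j := \<gamma> (x j)))) \<epsilon> \<alpha> \<beta>"
proof -
  interpret marked_averaging_operator n scale L bracket \<epsilon> \<alpha> \<beta> \<gamma> i j
    using assms(3-6)
    by (simp add: marked_averaging_operator_def marked_averaging_operator_axioms_def)
  have "n_BiHom_Lie_color_algebra n scale L averaged \<epsilon> \<alpha> \<beta>"
    by unfold_locales
      (fact averaged_even_multilinear bicharacter even_alpha even_beta commute
        averaged_skew_symmetry averaged_Jacobi)+
  then show ?thesis
    unfolding averaged_def[abs_def] .
qed

end
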